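(* For all integers $n\ge k\ge 0$ and $r>0$, $$S^B_{n+r,k+r,r}=\sum_{j=k}^n\binom{n}{j}S^B_{j,k}\,(2r)^{n-j}.$$
   Context: A set partition of $[\pm n]=\{\pm1,\dots,\pm n\}$ of type $B$ is a set partition of $[\pm n]$ such that (i) if $B$ is a block then $-B=\{-b: b\in B\}$ is also a block, and (ii) there is at most one block with $B=-B$ (called the zero block). The non-zero blocks come in pairs $\{B,-B\}$, and each pair is counted as one (representative) non-zero block. $S^B_{n,k}$ is the number of set partitions of $[\pm n]$ of type $B$ with exactly $k$ (representative) non-zero blocks. $S^B_{n,k,r}$ is the number of those in which none of $1,\dots,r$ lies in the zero block and $1,\dots,r$ lie in pairwise distinct pairs $\{B,-B\}$; $S^B_{n,k,r}=0$ if $n<r$. *)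

theory Defs
  imports Main "HOL-Library.Disjoint_Sets"
begin

definition pm_set :: "nat \<Rightarrow> int set" where
  "pm_set n = {- int n..int n} - {0}"

definition is_zero_block :: "int set \<Rightarrow> bool" where
  "is_zero_block B \<longleftrightarrow> uminus ` B = B"

definition type_B_partition :: "nat \<Rightarrow> int set set \<Rightarrow> bool" where
  "type_B_partition n P \<longleftrightarrow>
     partition_on (pm_set n) P \<and>
     (\<forall>B\<in>P. uminus ` B \<in> P) \<and>
     (\<forall>B\<in>P. \<forall>C\<in>P. is_zero_block B \<longrightarrow> is_zero_block C \<longrightarrow> B = C)"

definition block_pair :: "int set \<Rightarrow> int set set" where
  "block_pair B = {B, uminus ` B}"

text \<open>A representative non-zero block is counted as the unordered pair it forms with its negative.\<close>

definition nonzero_block_pairs :: "int set set \<Rightarrow> int set set set" where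
  "nonzero_block_pairs P = block_pair ` {B \<in> P. \<not> is_zero_block B}"

definition stirling_B :: "nat \<Rightarrow> nat \<Rightarrow> nat" where
  "stirling_B n k = card {P. type_B_partition n P \<and> card (nonzero_block_pairs P) = k}"

definition r_separated :: "nat \<Rightarrow> int set set \<Rightarrow> bool" where
  "r_separated r P \<longleftrightarrow>
     (\<forall>i\<in>{1..int r}. \<forall>B\<in>P. i \<in> B \<longrightarrow> \<not> is_zero_block B) \<and>
     (\<forall>i\<in>{1..int r}. \<forall>j\<in>{1..int r}. \<forall>B\<in>P. \<forall>C\<in>P.
        i \<noteq> j \<longrightarrow> i \<in> B \<longrightarrow> j \<in> C \<longrightarrow> block_pair B \<noteq> block_pair C)"

text \<open>
  The case \<open>n < r\<close> is separate because \<open>r_separated\<close> imposes no condition on the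
  elements of \<open>{1..r}\<close> that lie in no block.
\<close>

definition r_stirling_B :: "nat \<Rightarrow> nat \<Rightarrow> nat \<Rightarrow> nat" where
  "r_stirling_B n k r =
     (if n < r then 0
      else card {P. type_B_partition n P \<and> card (nonzero_block_pairs P) = k \<and> r_separated r P})"

end

theory Submission
  imports Defs
begin

text \<open>
  Both sides of the identity satisfy the same recurrence in \<open>n\<close> with the same initial values.

  The recurrence for the left side comes from removing the largest element \<open>x = n + 1\<close> and its
  negative from a type B partition of \<open>[\<plusminus>(n + 1)]\<close>. Given the partition \<open>Q\<close> of \<open>[\<plusminus>n]\<close> that
  remains, the original is determined by the block \<open>A\<close> that contained \<open>x\<close>
  (\<open>bij_betw_extend_by\<close>). Either \<open>A = {x}\<close>, which creates a new pair of non-zero blocks; or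
  \<open>x\<close> was added to one of the \<open>2k\<close> non-zero blocks of \<open>Q\<close>, and \<open>-x\<close> to its negative; or both
  \<open>x\<close> and \<open>-x\<close> were added to the zero block, which is created if \<open>Q\<close> has none. If \<open>r \<le> n\<close>,
  then none of this affects whether \<open>1, ..., r\<close> are separated. This gives
  \[S^B_{n+1,k,r} = S^B_{n,k-1,r} + (2k+1) S^B_{n,k,r} \quad (n \ge r)\]
  in \<open>r_stirling_B_Suc\<close>. The initial values are in \<open>r_stirling_B_diag\<close>: the only separated partition
  of \<open>[\<plusminus>r]\<close> is the one into singletons. As separation is void for \<open>r = 0\<close>, the
  numbers \<open>S^B_{n,k}\<close> are the case \<open>r = 0\<close> of the same recurrence.

  Let \<open>G(n, k)\<close> be the sum on the right. Pascal's rule (\<open>sum_choose_Suc\<close>) and the recurrence for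
  \<open>S^B_{j,k}\<close> give \<open>G(n+1, k) = 2r G(n, k) + G(n, k-1) + (2k+1) G(n, k)\<close>, and
  \<open>2r + 2k + 1 = 2(k + r) + 1\<close> is the coefficient in the recurrence for \<open>S^B_{n+r,k+r,r}\<close>.
\<close>

section \<open>Blocks of a type B partition\<close>

lemma mem_uminus_image: "a \<in> uminus ` B \<longleftrightarrow> - a \<in> B" for a :: int
  by force

lemma uminus_image_uminus_image [simp]: "uminus ` uminus ` B = B" for B :: "int set"
  by (simp add: image_image)

lemma uminus_image_eq_iff: "uminus ` B = C \<longleftrightarrow> B = uminus ` C" for B C :: "int set"
  by (metis uminus_image_uminus_image)

lemma is_zero_block_uminus [simp]: "is_zero_block (uminus ` B) \<longleftrightarrow> is_zero_block B"
  unfolding is_zero_block_def by (metis uminus_image_uminus_image)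

lemma finite_pm_set [simp]: "finite (pm_set n)"
  by (simp add: pm_set_def)

lemma uminus_mem_pm_set [simp]: "- a \<in> pm_set n \<longleftrightarrow> a \<in> pm_set n"
  by (auto simp: pm_set_def)

lemma pm_set_Suc: "pm_set (Suc n) = insert (int n + 1) (insert (- (int n + 1)) (pm_set n))"
  by (auto simp: pm_set_def)

lemma type_B_partitionI:
  assumes "\<And>B a. B \<in> P \<Longrightarrow> a \<in> B \<Longrightarrow> a \<in> pm_set n"
    and "\<And>a. a \<in> pm_set n \<Longrightarrow> \<exists>B\<in>P. a \<in> B"
    and "\<And>B C a. B \<in> P \<Longrightarrow> C \<in> P \<Longrightarrow> a \<in> B \<Longrightarrow> a \<in> C \<Longrightarrow> B = C"
    and "{} \<notin> P"
    and "\<And>B. B \<in> P \<Longrightarrow> uminus ` B \<in> P"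
    and "\<And>B C. B \<in> P \<Longrightarrow> C \<in> P \<Longrightarrow> is_zero_block B \<Longrightarrow> is_zero_block C \<Longrightarrow> B = C"
  shows "type_B_partition n P"
proof -
  have "\<Union> P = pm_set n" using assms(1,2) by blast
  moreover have "disjoint P" unfolding disjoint_def using assms(3) by blast
  ultimately show ?thesis
    unfolding type_B_partition_def partition_on_def using assms(4-6) by blast
qed

lemma
  assumes "type_B_partition n P"
  shows type_B_block_subset: "B \<in> P \<Longrightarrow> B \<subseteq> pm_set n"
    and type_B_cover: "a \<in> pm_set n \<Longrightarrow> \<exists>B\<in>P. a \<in> B"
    and type_B_block_unique: "B \<in> P \<Longrightarrow> C \<in> P \<Longrightarrow> a \<in> B \<Longrightarrow> a \<in> C \<Longrightarrow> B = C"
    and type_B_empty: "{} \<notin> P"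
    and type_B_uminus: "B \<in> P \<Longrightarrow> uminus ` B \<in> P"
    and type_B_zero_unique:
      "B \<in> P \<Longrightarrow> C \<in> P \<Longrightarrow> is_zero_block B \<Longrightarrow> is_zero_block C \<Longrightarrow> B = C"
proof -
  have p: "\<Union> P = pm_set n" "disjoint P" "{} \<notin> P"
    using assms unfolding type_B_partition_def partition_on_def by auto
  show "B \<in> P \<Longrightarrow> B \<subseteq> pm_set n" "a \<in> pm_set n \<Longrightarrow> \<exists>B\<in>P. a \<in> B"
    using p(1) by blast+
  show "B \<in> P \<Longrightarrow> C \<in> P \<Longrightarrow> a \<in> B \<Longrightarrow> a \<in> C \<Longrightarrow> B = C"
    using p(2) unfolding disjoint_def by blast
  show "{} \<notin> P" by (fact p(3))
  show "B \<in> P \<Longrightarrow> uminus ` B \<in> P"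
    "B \<in> P \<Longrightarrow> C \<in> P \<Longrightarrow> is_zero_block B \<Longrightarrow> is_zero_block C \<Longrightarrow> B = C"
    using assms unfolding type_B_partition_def by blast+
qed

lemma finite_type_B_partition: "type_B_partition n P \<Longrightarrow> finite P"
  by (meson finite_Pow_iff finite_pm_set finite_subset Pow_iff subsetI type_B_block_subset)

lemma finite_type_B_partitions: "finite {P. type_B_partition n P}"
  by (rule finite_subset[of _ "Pow (Pow (pm_set n))"]) (use type_B_block_subset in auto)

text \<open>
  If \<open>b\<close> and \<open>-b\<close> share a block, then that block and its negative overlap and hence coincide.
  So being a zero block can be tested on single elements, and the test survives restriction.
\<close>

lemma zero_block_iff:
  assumes "type_B_partition n P" "B \<in> P"
  shows "is_zero_block B \<longleftrightarrow> (\<exists>b\<in>B. - b \<in> B)"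
proof
  assume z: "is_zero_block B"
  obtain b where "b \<in> B" using type_B_empty[OF assms(1)] assms(2) by (metis ex_in_conv)
  moreover from this have "- b \<in> B" using z unfolding is_zero_block_def by blast
  ultimately show "\<exists>b\<in>B. - b \<in> B" by blast
next
  assume "\<exists>b\<in>B. - b \<in> B"
  then show "is_zero_block B"
    unfolding is_zero_block_def
    using type_B_block_unique[OF assms(1)] type_B_uminus[OF assms] assms(2) mem_uminus_image
    by metis
qed

definition nonzero_blocks :: "int set set \<Rightarrow> int set set" where
  "nonzero_blocks P = {B \<in> P. \<not> is_zero_block B}"

text \<open>
  The pairs \<open>{B, -B}\<close> cut the set of non-zero blocks into classes of size two. This
  replaces the counting of pairs by the counting of blocks.
\<close>

lemma card_nonzero_blocks:
  assumes P: "type_B_partition n P"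
  shows "card (nonzero_blocks P) = 2 * card (nonzero_block_pairs P)"
proof -
  have u: "\<Union> (nonzero_block_pairs P) = nonzero_blocks P"
    using type_B_uminus[OF P]
    unfolding nonzero_block_pairs_def nonzero_blocks_def block_pair_def by auto
  have f: "finite (nonzero_blocks P)"
    using finite_type_B_partition[OF P] unfolding nonzero_blocks_def by simp
  have "2 * card (nonzero_block_pairs P) = card (\<Union> (nonzero_block_pairs P))"
  proof (rule card_partition)
    show "finite (nonzero_block_pairs P)"
      using f unfolding nonzero_block_pairs_def nonzero_blocks_def by simp
    show "finite (\<Union> (nonzero_block_pairs P))" using f u by simp
    show "card c = 2" if "c \<in> nonzero_block_pairs P" for c
    proof -
      from that obtain B where "\<not> is_zero_block B" "c = block_pair B"
        unfolding nonzero_block_pairs_def by blast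
      then have "c = {B, uminus ` B}" "B \<noteq> uminus ` B"
        by (simp_all add: block_pair_def is_zero_block_def eq_commute)
      then show ?thesis by (metis card_2_iff)
    qed
    show "c \<inter> d = {}" if "c \<in> nonzero_block_pairs P" "d \<in> nonzero_block_pairs P" "c \<noteq> d" for c d
      using that unfolding nonzero_block_pairs_def block_pair_def
      by (auto simp: uminus_image_eq_iff)
  qed
  then show ?thesis using u by simp
qed

text \<open>
  An elementwise form of separation. The case \<open>j = i\<close> of the condition \<open>- j \<notin> B\<close> keeps \<open>i\<close> out of
  the zero block; the other cases say that \<open>i\<close> and \<open>j\<close> belong to different pairs. Since only
  elements of absolute value at most \<open>r\<close> are tested, larger elements may be removed freely.
\<close>

lemma r_separated_iff:
  assumes P: "type_B_partition n P"
  shows "r_separated r P \<longleftrightarrow>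
    (\<forall>B\<in>P. \<forall>i\<in>{1..int r} \<inter> B. \<forall>j\<in>{1..int r}. - j \<notin> B \<and> (j \<in> B \<longrightarrow> j = i))"
    (is "?L \<longleftrightarrow> ?R")
proof
  assume L: ?L
  show ?R
  proof (intro ballI conjI impI)
    fix B i j
    assume h: "B \<in> P" "i \<in> {1..int r} \<inter> B" "j \<in> {1..int r}"
    show "- j \<notin> B"
    proof
      assume "- j \<in> B"
      then have j: "j \<in> uminus ` B" by (simp add: mem_uminus_image)
      have "i \<noteq> j"
        using L h \<open>- j \<in> B\<close> zero_block_iff[OF P h(1)] unfolding r_separated_def by auto
      then have "block_pair B \<noteq> block_pair (uminus ` B)"
        using L[unfolded r_separated_def, THEN conjunct2, rule_format, of i j B "uminus ` B"]
          h j type_B_uminus[OF P h(1)] by blast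
      then show False by (auto simp: block_pair_def)
    qed
    show "j = i" if "j \<in> B"
      using L h that unfolding r_separated_def by blast
  qed
next
  assume R: ?R
  show ?L
    unfolding r_separated_def
  proof (intro conjI ballI impI)
    fix i B
    assume h: "i \<in> {1..int r}" "B \<in> P" "i \<in> B"
    then have "- i \<notin> B" using R by blast
    then show "\<not> is_zero_block B"
      using h(3) unfolding is_zero_block_def by blast
  next
    fix i j B C
    assume h: "i \<in> {1..int r}" "j \<in> {1..int r}" "B \<in> P" "C \<in> P" "i \<noteq> j" "i \<in> B" "j \<in> C"
    show "block_pair B \<noteq> block_pair C"
    proof
      assume "block_pair B = block_pair C"
      then have "C = B \<or> C = uminus ` B" by (auto simp: block_pair_def doubleton_eq_iff)
      then have "j \<in> B \<or> - j \<in> B" using h(7) by (auto simp: mem_uminus_image)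
      then show False using R h by blast
    qed
  qed
qed

section \<open>Adding a largest element and its negative\<close>

definition restrict_blocks :: "nat \<Rightarrow> int set set \<Rightarrow> int set set" where
  "restrict_blocks n P = (\<lambda>B. B \<inter> pm_set n) ` P - {{}}"

text \<open>
  The inverse of the restriction, when \<open>A\<close> is the block that the new largest element is to have. The
  blocks of \<open>Q\<close> that have been enlarged to \<open>A\<close> and \<open>-A\<close> are precisely those that meet them, so one
  formula serves for a new pair of blocks, an enlarged pair and an enlarged zero block.
\<close>

definition extend_by :: "int set set \<Rightarrow> int set \<Rightarrow> int set set" where
  "extend_by Q A = {B \<in> Q. B \<inter> (A \<union> uminus ` A) = {}} \<union> {A, uminus ` A}"

text \<open>The zero block, or the empty set if there is none.\<close>

definition zero_part :: "int set set \<Rightarrow> int set" where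
  "zero_part Q = \<Union> {B \<in> Q. is_zero_block B}"

definition new_block_choices :: "nat \<Rightarrow> int set set \<Rightarrow> int set set" where
  "new_block_choices n Q = insert {int n + 1}
     (insert ({int n + 1, - (int n + 1)} \<union> zero_part Q)
       (insert (int n + 1) ` nonzero_blocks Q))"

lemma zero_part_cases:
  assumes Q: "type_B_partition n Q"
  obtains "zero_part Q = {}" "\<And>B. B \<in> Q \<Longrightarrow> \<not> is_zero_block B"
  | "zero_part Q \<in> Q" "is_zero_block (zero_part Q)"
proof (cases "\<exists>B\<in>Q. is_zero_block B")
  case True
  then obtain B where B: "B \<in> Q" "is_zero_block B" by blast
  then have "{B \<in> Q. is_zero_block B} = {B}" using type_B_zero_unique[OF Q] by blast
  then have "zero_part Q = B" by (simp add: zero_part_def)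
  then show ?thesis using B that(2) by blast
next
  case False
  then show ?thesis using that(1) by (auto simp: zero_part_def)
qed

text \<open>
  The singleton and the enlarged non-zero blocks behave alike: both arise by adding the new element
  to a set \<open>X\<close> disjoint from its negative, with \<open>X = {}\<close> in the first case.
\<close>

lemma new_block_choices_cases:
  assumes Q: "type_B_partition n Q" and A: "A \<in> new_block_choices n Q"
  obtains (zero) "A = {int n + 1, - (int n + 1)} \<union> zero_part Q" "uminus ` A = A"
      "A \<inter> pm_set n = zero_part Q" "zero_part Q \<in> insert {} Q"
  | (nonzero) X where "A = insert (int n + 1) X" "A \<inter> uminus ` A = {}"
      "A \<inter> pm_set n = X" "X \<in> insert {} Q"
proof -
  define x where "x = int n + 1"
  have x: "x \<notin> pm_set n" "- x \<notin> pm_set n" "x \<noteq> - x"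
    by (auto simp: x_def pm_set_def)
  have nz: ?thesis if X: "A = insert x X" "X \<in> insert {} Q" "X \<inter> uminus ` X = {}" for X
  proof -
    have s: "X \<subseteq> pm_set n" using X(2) type_B_block_subset[OF Q] by blast
    then have "x \<notin> X" "- x \<notin> X" using x by blast+
    then have "A \<inter> uminus ` A = {}" using X(3) x(3) unfolding X(1) by (auto simp: mem_uminus_image)
    moreover have "A \<inter> pm_set n = X" using s x unfolding X(1) by blast
    ultimately show ?thesis using nonzero X(1,2) x_def by blast
  qed
  from A consider "A = {x}" | "A = {x, - x} \<union> zero_part Q"
    | B where "B \<in> nonzero_blocks Q" "A = insert x B"
    unfolding new_block_choices_def x_def by blast
  then show ?thesis
  proof cases
    case 1
    then show ?thesis using nz[of "{}"] by simp
  next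
    case 2
    have z: "zero_part Q \<in> insert {} Q" "uminus ` zero_part Q = zero_part Q"
      using zero_part_cases[OF Q] by (auto simp: is_zero_block_def)
    then have "zero_part Q \<subseteq> pm_set n" using type_B_block_subset[OF Q] by blast
    then have "A \<inter> pm_set n = zero_part Q" using x 2 by blast
    moreover have "uminus ` A = A" unfolding 2 image_Un z(2) by auto
    ultimately show ?thesis using zero z(1) 2 x_def by blast
  next
    case 3
    then have "B \<in> Q" "\<not> (\<exists>b\<in>B. - b \<in> B)"
      using zero_block_iff[OF Q] by (auto simp: nonzero_blocks_def)
    then show ?thesis using nz[OF 3(2)] by (auto simp: mem_uminus_image)
  qed
qed

lemma new_block_choices_facts:
  assumes Q: "type_B_partition n Q" and A: "A \<in> new_block_choices n Q"
  shows "int n + 1 \<in> A" "A \<subseteq> pm_set (Suc n)" "A \<inter> pm_set n \<in> insert {} Q"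
    "- (int n + 1) \<in> A \<Longrightarrow> uminus ` A = A"
    "B \<in> Q \<Longrightarrow> uminus ` A = A \<Longrightarrow> is_zero_block B \<Longrightarrow> B \<subseteq> A"
proof -
  have s: "X \<in> insert {} Q \<Longrightarrow> X \<subseteq> pm_set n" for X using type_B_block_subset[OF Q] by blast
  from Q A show "int n + 1 \<in> A" by (cases rule: new_block_choices_cases) auto
  from Q A show "A \<subseteq> pm_set (Suc n)"
    unfolding pm_set_Suc by (cases rule: new_block_choices_cases) (use s in blast)+
  from Q A show "A \<inter> pm_set n \<in> insert {} Q"
    by (cases rule: new_block_choices_cases) simp_all
  from Q A show "uminus ` A = A" if "- (int n + 1) \<in> A"
  proof (cases rule: new_block_choices_cases)
    case (nonzero X)
    then have "int n + 1 \<in> A \<inter> uminus ` A" using that by (auto simp: mem_uminus_image)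
    then show ?thesis using nonzero(2) by blast
  qed
  from Q A show "B \<subseteq> A" if "B \<in> Q" "uminus ` A = A" "is_zero_block B"
  proof (cases rule: new_block_choices_cases)
    case zero
    then show ?thesis using that unfolding zero_part_def by blast
  next
    case (nonzero X)
    then show ?thesis using that(2) by blast
  qed
qed

lemma extend_by_type_B:
  assumes Q: "type_B_partition n Q" and A: "A \<in> new_block_choices n Q"
  shows "type_B_partition (Suc n) (extend_by Q A)"
proof (rule type_B_partitionI)
  note c = new_block_choices_facts[OF Q A]
  have dj: "A = uminus ` A \<or> A \<inter> uminus ` A = {}"
    using Q A by (cases rule: new_block_choices_cases) auto
  have neg: "uminus ` A \<subseteq> pm_set (Suc n)" using c(2) by auto
  show "a \<in> pm_set (Suc n)" if "B \<in> extend_by Q A" "a \<in> B" for B a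
    using that c(2) neg type_B_block_subset[OF Q, of B] unfolding extend_by_def pm_set_Suc
    by blast
  \<comment> \<open>A block of \<open>Q\<close> that meets \<open>A\<close> is \<open>A \<inter> pm_set n\<close>, and one that meets \<open>-A\<close> is its negative.
      So discarding them loses no element outside \<open>A\<close> and \<open>-A\<close>.\<close>
  show "\<exists>B\<in>extend_by Q A. a \<in> B" if a: "a \<in> pm_set (Suc n)" for a
  proof (cases "a \<in> A \<union> uminus ` A")
    case True
    then show ?thesis unfolding extend_by_def by blast
  next
    case False
    then have "a \<notin> A" "- a \<notin> A" by (auto simp: mem_uminus_image)
    then have "a \<noteq> int n + 1" "a \<noteq> - (int n + 1)" using c(1) by (metis minus_minus)+
    then have "a \<in> pm_set n" using a unfolding pm_set_Suc by blast
    then obtain B where B: "B \<in> Q" "a \<in> B" using type_B_cover[OF Q] by blast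
    have "b \<notin> A \<and> b \<notin> uminus ` A" if b: "b \<in> B" for b
    proof -
      have s: "B \<subseteq> pm_set n" using type_B_block_subset[OF Q] B by blast
      have "b \<notin> A"
        using type_B_block_unique[OF Q, of B "A \<inter> pm_set n" b] c(3) b B s False by blast
      moreover have "b \<notin> uminus ` A"
      proof
        assume "b \<in> uminus ` A"
        then have "- b \<in> A" by (simp add: mem_uminus_image)
        then have "- b \<in> A \<inter> pm_set n" using b s by auto
        moreover from this have "A \<inter> pm_set n \<in> Q" using c(3) by blast
        moreover have "- b \<in> uminus ` B" using b by blast
        ultimately have "uminus ` B = A \<inter> pm_set n"
          using type_B_block_unique[OF Q] type_B_uminus[OF Q B(1)] by metis
        then have "- a \<in> A" using B(2) by blast
        then show False using False by (simp add: mem_uminus_image)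
      qed
      ultimately show ?thesis ..
    qed
    then have "B \<inter> (A \<union> uminus ` A) = {}" by blast
    then show ?thesis using B unfolding extend_by_def by blast
  qed
  show "B = C" if "B \<in> extend_by Q A" "C \<in> extend_by Q A" "a \<in> B" "a \<in> C" for B C a
  proof (cases "a \<in> A \<union> uminus ` A")
    case True
    have "E = A \<or> E = uminus ` A" if "E \<in> extend_by Q A" "a \<in> E" for E
      using that True unfolding extend_by_def by blast
    then have "B = A \<or> B = uminus ` A" "C = A \<or> C = uminus ` A" using that by metis+
    then show ?thesis using dj that(3,4) by blast
  next
    case False
    have "E \<in> Q" if "E \<in> extend_by Q A" "a \<in> E" for E
      using that False unfolding extend_by_def by blast
    then show ?thesis using type_B_block_unique[OF Q] that by metis
  qed
  show "{} \<notin> extend_by Q A"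
    using type_B_empty[OF Q] c(1) unfolding extend_by_def by auto
  show "uminus ` B \<in> extend_by Q A" if "B \<in> extend_by Q A" for B
  proof (cases "B = A \<or> B = uminus ` A")
    case True
    then show ?thesis unfolding extend_by_def by auto
  next
    case False
    then have B: "B \<in> Q" "B \<inter> (A \<union> uminus ` A) = {}" using that unfolding extend_by_def by auto
    then have "uminus ` B \<inter> (A \<union> uminus ` A) = {}" by force
    then show ?thesis using type_B_uminus[OF Q B(1)] unfolding extend_by_def by blast
  qed
  show "B = C" if "B \<in> extend_by Q A" "C \<in> extend_by Q A" "is_zero_block B" "is_zero_block C"
    for B C
  proof (cases "uminus ` A = A")
    case True
    have "E = A" if "E \<in> extend_by Q A" "is_zero_block E" for E
    proof (rule ccontr)
      assume "E \<noteq> A"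
      then have E: "E \<in> Q" "E \<inter> A = {}" using that(1) True unfolding extend_by_def by auto
      then have "E \<subseteq> A" using c(5)[OF _ True that(2)] by blast
      then show False using E type_B_empty[OF Q] by (metis inf.absorb1)
    qed
    then show ?thesis using that by metis
  next
    case False
    have "E \<in> Q" if "E \<in> extend_by Q A" "is_zero_block E" for E
      using that False unfolding extend_by_def is_zero_block_def by auto
    then show ?thesis using that type_B_zero_unique[OF Q] by metis
  qed
qed

lemma restrict_extend_by:
  assumes Q: "type_B_partition n Q" and A: "A \<in> new_block_choices n Q"
  shows "restrict_blocks n (extend_by Q A) = Q"
proof -
  note c = new_block_choices_facts[OF Q A]
  have s: "B \<subseteq> pm_set n" if "B \<in> Q" for B using type_B_block_subset[OF Q that] .
  have neg: "uminus ` A \<inter> pm_set n = uminus ` (A \<inter> pm_set n)" by (auto simp: mem_uminus_image)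
  have neg': "uminus ` A \<inter> pm_set n \<in> insert {} Q"
    unfolding neg using c(3) type_B_uminus[OF Q] by auto
  show ?thesis
  proof (intro equalityI subsetI)
    fix B assume "B \<in> restrict_blocks n (extend_by Q A)"
    then obtain C where C: "C \<in> extend_by Q A" "B = C \<inter> pm_set n" "B \<noteq> {}"
      unfolding restrict_blocks_def by blast
    then consider "C \<in> Q" | "C = A" | "C = uminus ` A" unfolding extend_by_def by blast
    then show "B \<in> Q"
      by cases (use C c(3) neg' s in \<open>auto simp: Int_absorb2\<close>)
  next
    fix B assume B: "B \<in> Q"
    have "\<exists>C\<in>extend_by Q A. B = C \<inter> pm_set n"
    proof (cases "B \<inter> (A \<union> uminus ` A) = {}")
      case True
      then show ?thesis using B s unfolding extend_by_def by blast
    next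
      case False
      then obtain b where b: "b \<in> B" "b \<in> A \<or> b \<in> uminus ` A" by blast
      have "b \<in> pm_set n" using b s B by blast
      then have "B = A \<inter> pm_set n \<or> B = uminus ` A \<inter> pm_set n"
        using b type_B_block_unique[OF Q B] c(3) neg' by blast
      then show ?thesis unfolding extend_by_def by blast
    qed
    then show "B \<in> restrict_blocks n (extend_by Q A)"
      using B type_B_empty[OF Q] unfolding restrict_blocks_def by blast
  qed
qed

lemma restrict_blocks_type_B:
  assumes P: "type_B_partition (Suc n) P"
  shows "type_B_partition n (restrict_blocks n P)"
proof (rule type_B_partitionI)
  have sub: "pm_set n \<subseteq> pm_set (Suc n)" by (auto simp: pm_set_Suc)
  show "a \<in> pm_set n" if "B \<in> restrict_blocks n P" "a \<in> B" for B a
    using that unfolding restrict_blocks_def by blast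
  show "\<exists>B\<in>restrict_blocks n P. a \<in> B" if "a \<in> pm_set n" for a
    using that type_B_cover[OF P, of a] sub unfolding restrict_blocks_def by blast
  show "B = C" if "B \<in> restrict_blocks n P" "C \<in> restrict_blocks n P" "a \<in> B" "a \<in> C" for B C a
    using that type_B_block_unique[OF P, of _ _ a] unfolding restrict_blocks_def by blast
  show "{} \<notin> restrict_blocks n P" unfolding restrict_blocks_def by blast
  show "uminus ` B \<in> restrict_blocks n P" if B: "B \<in> restrict_blocks n P" for B
  proof -
    obtain C where C: "C \<in> P" "B = C \<inter> pm_set n" "B \<noteq> {}"
      using B unfolding restrict_blocks_def by blast
    have "uminus ` B = uminus ` C \<inter> pm_set n" unfolding C(2) by (auto simp: mem_uminus_image)
    then show ?thesis using C(3) type_B_uminus[OF P C(1)] unfolding restrict_blocks_def by blast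
  qed
  show "B = C" if BC: "B \<in> restrict_blocks n P" "C \<in> restrict_blocks n P"
    "is_zero_block B" "is_zero_block C" for B C
  proof -
    have lift: "\<exists>D\<in>P. E = D \<inter> pm_set n \<and> is_zero_block D"
      if E: "E \<in> restrict_blocks n P" "is_zero_block E" for E
    proof -
      obtain D where D: "D \<in> P" "E = D \<inter> pm_set n" "E \<noteq> {}"
        using E unfolding restrict_blocks_def by blast
      then obtain e where "e \<in> E" by blast
      moreover from this have "- e \<in> E" using E(2) unfolding is_zero_block_def by blast
      ultimately have "is_zero_block D" using zero_block_iff[OF P D(1)] D(2) by blast
      then show ?thesis using D by blast
    qed
    show ?thesis using lift[OF BC(1,3)] lift[OF BC(2,4)] type_B_zero_unique[OF P] by blast
  qed
qed

lemma block_in_new_block_choices: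
  assumes P: "type_B_partition (Suc n) P" and A: "A \<in> P" "int n + 1 \<in> A"
  shows "A \<in> new_block_choices n (restrict_blocks n P)"
proof -
  define x where "x = int n + 1"
  define Q where "Q = restrict_blocks n P"
  have Q: "type_B_partition n Q" unfolding Q_def by (rule restrict_blocks_type_B[OF P])
  have xA: "x \<in> A" using A x_def by simp
  have sA: "A \<subseteq> insert x (insert (- x) (pm_set n))"
    using type_B_block_subset[OF P A(1)] unfolding pm_set_Suc x_def .
  show ?thesis
  proof (cases "- x \<in> A")
    case True
    then have zA: "is_zero_block A" using zero_block_iff[OF P A(1)] xA by blast
    have "zero_part Q = A \<inter> pm_set n"
    proof (intro equalityI subsetI)
      fix a assume "a \<in> zero_part Q"
      then obtain B where B: "B \<in> Q" "is_zero_block B" "a \<in> B" unfolding zero_part_def by blast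
      obtain D where D: "D \<in> P" "B = D \<inter> pm_set n"
        using B(1) unfolding Q_def restrict_blocks_def by blast
      have "- a \<in> B" using B unfolding is_zero_block_def by blast
      then have "is_zero_block D" using zero_block_iff[OF P D(1)] D(2) B(3) by blast
      then have "D = A" using type_B_zero_unique[OF P] zA D A by blast
      then show "a \<in> A \<inter> pm_set n" using B(3) D(2) by blast
    next
      fix a assume a: "a \<in> A \<inter> pm_set n"
      then have "- a \<in> A \<inter> pm_set n" using zA unfolding is_zero_block_def by auto
      moreover have i: "A \<inter> pm_set n \<in> Q" using A(1) a unfolding Q_def restrict_blocks_def by blast
      ultimately have "is_zero_block (A \<inter> pm_set n)" using a zero_block_iff[OF Q] by blast
      then show "a \<in> zero_part Q" using a i unfolding zero_part_def by blast
    qed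
    then have "A = {x, - x} \<union> zero_part Q" using sA xA True by blast
    then show ?thesis unfolding new_block_choices_def x_def Q_def by blast
  next
    case False
    then have e: "A = insert x (A \<inter> pm_set n)" using sA xA by blast
    show ?thesis
    proof (cases "A \<inter> pm_set n = {}")
      case True
      then show ?thesis using e unfolding new_block_choices_def x_def by simp
    next
      case ne: False
      then have i: "A \<inter> pm_set n \<in> Q" using A(1) unfolding Q_def restrict_blocks_def by blast
      have "\<not> is_zero_block A" using False xA unfolding is_zero_block_def by blast
      then have "\<not> is_zero_block (A \<inter> pm_set n)"
        using zero_block_iff[OF P A(1)] zero_block_iff[OF Q i] by blast
      then have "A \<inter> pm_set n \<in> nonzero_blocks Q" using i by (simp add: nonzero_blocks_def)
      then have "A \<in> insert x ` nonzero_blocks Q" using e by blast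
      then show ?thesis unfolding new_block_choices_def x_def Q_def by blast
    qed
  qed
qed

lemma extend_by_restrict:
  assumes P: "type_B_partition (Suc n) P" and A: "A \<in> P" "int n + 1 \<in> A"
  shows "extend_by (restrict_blocks n P) A = P"
proof -
  have A': "uminus ` A \<in> P" using type_B_uminus[OF P A(1)] .
  have keep: "B \<inter> pm_set n = B \<and> B \<inter> (A \<union> uminus ` A) = {}"
    if B: "B \<in> P" "B \<noteq> A" "B \<noteq> uminus ` A" for B
  proof -
    have d: "B \<inter> A = {}" "B \<inter> uminus ` A = {}"
      using type_B_block_unique[OF P B(1)] A(1) A' B(2,3) by blast+
    moreover have "- (int n + 1) \<in> uminus ` A" using A(2) by blast
    ultimately have "int n + 1 \<notin> B" "- (int n + 1) \<notin> B" using A(2) by blast+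
    then show ?thesis using d type_B_block_subset[OF P B(1)] unfolding pm_set_Suc by blast
  qed
  show ?thesis
  proof (intro equalityI subsetI)
    fix B assume "B \<in> extend_by (restrict_blocks n P) A"
    then consider "B = A" | "B = uminus ` A"
      | "B \<in> restrict_blocks n P" "B \<inter> (A \<union> uminus ` A) = {}"
      unfolding extend_by_def by blast
    then show "B \<in> P"
    proof cases
      case 3
      then obtain D where D: "D \<in> P" "B = D \<inter> pm_set n" "B \<noteq> {}"
        unfolding restrict_blocks_def by blast
      then have "D \<noteq> A" "D \<noteq> uminus ` A" using 3(2) by blast+
      then show ?thesis using keep[OF D(1)] D by simp
    qed (use A(1) A' in auto)
  next
    fix B assume B: "B \<in> P"
    show "B \<in> extend_by (restrict_blocks n P) A"
    proof (cases "B = A \<or> B = uminus ` A")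
      case False
      then have "B \<in> restrict_blocks n P"
        using keep[OF B] B type_B_empty[OF P] unfolding restrict_blocks_def by blast
      then show ?thesis using keep[OF B] False unfolding extend_by_def by blast
    qed (auto simp: extend_by_def)
  qed
qed

lemma bij_betw_extend_by:
  "bij_betw (\<lambda>(Q, A). extend_by Q A)
     (SIGMA Q:{Q. type_B_partition n Q}. new_block_choices n Q)
     {P. type_B_partition (Suc n) P}"
  unfolding bij_betw_def
proof (intro conjI equalityI subsetI)
  show "inj_on (\<lambda>(Q, A). extend_by Q A)
    (SIGMA Q:{Q. type_B_partition n Q}. new_block_choices n Q)"
  proof (rule inj_onI, clarsimp)
    fix Q A R C
    assume h: "type_B_partition n Q" "A \<in> new_block_choices n Q"
      "type_B_partition n R" "C \<in> new_block_choices n R" "extend_by Q A = extend_by R C"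
    have "A \<in> extend_by Q A" "C \<in> extend_by R C" by (simp_all add: extend_by_def)
    then have "A = C"
      using h(5) type_B_block_unique[OF extend_by_type_B[OF h(1,2)]]
        new_block_choices_facts(1)[OF h(1,2)] new_block_choices_facts(1)[OF h(3,4)] by metis
    then show "Q = R \<and> A = C"
      using restrict_extend_by[OF h(1,2)] restrict_extend_by[OF h(3,4)] h(5) by metis
  qed
next
  fix P assume "P \<in> (\<lambda>(Q, A). extend_by Q A) `
    (SIGMA Q:{Q. type_B_partition n Q}. new_block_choices n Q)"
  then show "P \<in> {P. type_B_partition (Suc n) P}" using extend_by_type_B by auto
next
  fix P assume "P \<in> {P. type_B_partition (Suc n) P}"
  then have P: "type_B_partition (Suc n) P" by simp
  obtain A where A: "A \<in> P" "int n + 1 \<in> A"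
    using type_B_cover[OF P, of "int n + 1"] by (auto simp: pm_set_Suc)
  then have "(restrict_blocks n P, A) \<in> (SIGMA Q:{Q. type_B_partition n Q}. new_block_choices n Q)"
    using restrict_blocks_type_B[OF P] block_in_new_block_choices[OF P] by simp
  then show "P \<in> (\<lambda>(Q, A). extend_by Q A) `
      (SIGMA Q:{Q. type_B_partition n Q}. new_block_choices n Q)"
    using extend_by_restrict[OF P A] by force
qed

section \<open>The recurrence\<close>

text \<open>
  Apart from the singleton, the choices are the \<open>2k\<close> non-zero blocks and the zero block; the last
  counts as one choice whether or not \<open>Q\<close> has a zero block.
\<close>

lemma card_new_block_choices:
  assumes Q: "type_B_partition n Q"
  shows "card (new_block_choices n Q - {{int n + 1}}) = 2 * card (nonzero_block_pairs Q) + 1"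
proof -
  define x where "x = int n + 1"
  have x: "x \<notin> pm_set n" "- x \<notin> pm_set n" "x \<noteq> - x"
    by (auto simp: x_def pm_set_def)
  have b: "B \<noteq> {}" "x \<notin> B" "- x \<notin> B" if "B \<in> nonzero_blocks Q" for B
    using that x type_B_block_subset[OF Q] type_B_empty[OF Q] unfolding nonzero_blocks_def by blast+
  have f: "finite (nonzero_blocks Q)"
    using finite_type_B_partition[OF Q] unfolding nonzero_blocks_def by simp
  have "inj_on (insert x) (nonzero_blocks Q)"
    by (rule inj_onI) (metis b(2) insert_ident)
  then have c: "card (insert x ` nonzero_blocks Q) = 2 * card (nonzero_block_pairs Q)"
    by (simp add: card_image card_nonzero_blocks[OF Q])
  have "{x} \<notin> insert x ` nonzero_blocks Q" using b(1,2) by fastforce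
  moreover have "{x} \<noteq> {x, - x} \<union> zero_part Q"
    using x(3) by (metis UnI1 insertCI singletonD)
  ultimately have "{x} \<notin> insert ({x, - x} \<union> zero_part Q) (insert x ` nonzero_blocks Q)"
    by (metis insert_iff)
  then have "new_block_choices n Q - {{x}} =
      insert ({x, - x} \<union> zero_part Q) (insert x ` nonzero_blocks Q)"
    unfolding new_block_choices_def x_def[symmetric] by (rule Diff_insert_absorb)
  moreover have "{x, - x} \<union> zero_part Q \<notin> insert x ` nonzero_blocks Q"
  proof
    assume "{x, - x} \<union> zero_part Q \<in> insert x ` nonzero_blocks Q"
    then obtain B where B: "B \<in> nonzero_blocks Q" "{x, - x} \<union> zero_part Q = insert x B" by blast
    then have "- x \<in> insert x B" by blast
    then show False using b(3)[OF B(1)] x(3) by auto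
  qed
  ultimately show ?thesis using f c by (simp add: x_def)
qed

lemma card_nonzero_block_pairs_extend_by:
  assumes Q: "type_B_partition n Q" and A: "A \<in> new_block_choices n Q"
  shows "card (nonzero_block_pairs (extend_by Q A)) =
    (if A = {int n + 1} then 1 else 0) + card (nonzero_block_pairs Q)"
proof -
  define x where "x = int n + 1"
  have x: "x \<notin> pm_set n" "- x \<notin> pm_set n" "x \<noteq> - x"
    by (auto simp: x_def pm_set_def)
  have sub: "B \<subseteq> pm_set n" if "B \<in> Q" for B using type_B_block_subset[OF Q that] .
  have f: "finite (nonzero_blocks Q)"
    using finite_type_B_partition[OF Q] unfolding nonzero_blocks_def by simp
  have "card (nonzero_blocks (extend_by Q A)) = (if A = {x} then 2 else 0) + card (nonzero_blocks Q)"
    using Q A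
  proof (cases rule: new_block_choices_cases)
    case zero
    then have m: "- x \<in> A" by (simp add: x_def)
    have "B \<inter> A = {}" if B: "B \<in> Q" "\<not> is_zero_block B" for B
    proof (rule ccontr)
      assume "B \<inter> A \<noteq> {}"
      then obtain b where b: "b \<in> B" "b \<in> zero_part Q" using sub[OF B(1)] zero(3) by blast
      then have e: "B = zero_part Q" using zero(4) type_B_block_unique[OF Q B(1)] by blast
      show False by (rule zero_part_cases[OF Q]) (use B b e in auto)
    qed
    then have "nonzero_blocks (extend_by Q A) = nonzero_blocks Q"
      using zero(2) unfolding nonzero_blocks_def extend_by_def by (auto simp: is_zero_block_def)
    then show ?thesis using m x(3) by auto
  next
    case (nonzero X)
    have AA: "A \<noteq> uminus ` A" "x \<in> A" "- x \<in> uminus ` A" using nonzero(1,2) by (auto simp: x_def)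
    have nin: "A \<notin> Q" "uminus ` A \<notin> Q" using AA sub x by blast+
    have neg: "uminus ` A \<inter> pm_set n = uminus ` X"
      unfolding nonzero(3)[symmetric] by (auto simp: mem_uminus_image)
    have iff: "B \<inter> (A \<union> uminus ` A) = {} \<longleftrightarrow> B \<noteq> X \<and> B \<noteq> uminus ` X" if B: "B \<in> Q" for B
    proof -
      have "B \<inter> (A \<union> uminus ` A) = B \<inter> (X \<union> uminus ` X)"
        using sub[OF B] neg nonzero(3) by blast
      moreover have "B \<inter> Y = {} \<longleftrightarrow> B \<noteq> Y" if Y: "Y \<in> insert {} Q" for Y
      proof
        have ne: "B \<noteq> {}" using B type_B_empty[OF Q] by metis
        show "B \<noteq> Y" if "B \<inter> Y = {}" using that ne by auto
        show "B \<inter> Y = {}" if "B \<noteq> Y"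
          using that Y type_B_block_unique[OF Q B, of Y] by blast
      qed
      moreover have "uminus ` X \<in> insert {} Q" using nonzero(4) type_B_uminus[OF Q] by auto
      ultimately show ?thesis using nonzero(4) by (simp add: Int_Un_distrib)
    qed
    have n: "nonzero_blocks (extend_by Q A) =
        (nonzero_blocks Q - {X, uminus ` X}) \<union> {A, uminus ` A}"
    proof (rule set_eqI)
      fix E
      have "\<not> is_zero_block A" "\<not> is_zero_block (uminus ` A)"
        using AA(1) by (simp_all add: is_zero_block_def eq_commute)
      then show "E \<in> nonzero_blocks (extend_by Q A) \<longleftrightarrow>
          E \<in> (nonzero_blocks Q - {X, uminus ` X}) \<union> {A, uminus ` A}"
        using iff[of E] unfolding nonzero_blocks_def extend_by_def
        by (simp only: Un_iff mem_Collect_eq Diff_iff insert_iff empty_iff) metis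
    qed
    have "A \<notin> nonzero_blocks Q" "uminus ` A \<notin> nonzero_blocks Q"
      using nin by (auto simp: nonzero_blocks_def)
    then have c: "card (nonzero_blocks (extend_by Q A)) =
        card (nonzero_blocks Q - {X, uminus ` X}) + 2"
      unfolding n using f AA(1) by simp
    show ?thesis
    proof (cases "X = {}")
      case True
      then have "nonzero_blocks Q - {X, uminus ` X} = nonzero_blocks Q"
        using type_B_empty[OF Q] by (auto simp: nonzero_blocks_def)
      then show ?thesis using c True nonzero(1) by (simp add: x_def)
    next
      case False
      then have X: "X \<in> Q" using nonzero(4) by blast
      have "uminus ` X \<noteq> X" using nonzero(2,3) False by blast
      then have "{X, uminus ` X} \<subseteq> nonzero_blocks Q" "card {X, uminus ` X} = 2"
        using X type_B_uminus[OF Q X]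
        by (auto simp: nonzero_blocks_def is_zero_block_def)
      then have "card (nonzero_blocks Q - {X, uminus ` X}) + 2 = card (nonzero_blocks Q)"
        using f card_mono by (metis card_Diff_subset finite_subset le_add_diff_inverse2)
      moreover have "A \<noteq> {x}" using False nonzero(3) x(1) by auto
      ultimately show ?thesis using c by simp
    qed
  qed
  then show ?thesis
    unfolding card_nonzero_blocks[OF Q] card_nonzero_blocks[OF extend_by_type_B[OF Q A]] x_def
    by (simp split: if_splits)
qed

lemma r_separated_restrict_blocks:
  assumes P: "type_B_partition (Suc n) P" and r: "r \<le> n"
  shows "r_separated r (restrict_blocks n P) \<longleftrightarrow> r_separated r P"
proof -
  have i: "i \<in> pm_set n" if "i \<in> {1..int r}" for i using that r by (auto simp: pm_set_def)
  show ?thesis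
    unfolding r_separated_iff[OF P] r_separated_iff[OF restrict_blocks_type_B[OF P]]
  proof (intro iffI ballI)
    fix B k j
    assume R: "\<forall>B\<in>restrict_blocks n P. \<forall>i\<in>{1..int r} \<inter> B. \<forall>j\<in>{1..int r}.
        - j \<notin> B \<and> (j \<in> B \<longrightarrow> j = i)"
      and h: "B \<in> P" "k \<in> {1..int r} \<inter> B" "j \<in> {1..int r}"
    have "B \<inter> pm_set n \<in> restrict_blocks n P"
      using h(1,2) i unfolding restrict_blocks_def by blast
    moreover have "k \<in> {1..int r} \<inter> (B \<inter> pm_set n)" using h(2) i by blast
    ultimately have "- j \<notin> B \<inter> pm_set n \<and> (j \<in> B \<inter> pm_set n \<longrightarrow> j = k)"
      using R h(3) by (metis (no_types, lifting))
    then show "- j \<notin> B \<and> (j \<in> B \<longrightarrow> j = k)" using i[OF h(3)] by simp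
  next
    fix B k j
    assume R: "\<forall>B\<in>P. \<forall>i\<in>{1..int r} \<inter> B. \<forall>j\<in>{1..int r}. - j \<notin> B \<and> (j \<in> B \<longrightarrow> j = i)"
      and h: "B \<in> restrict_blocks n P" "k \<in> {1..int r} \<inter> B" "j \<in> {1..int r}"
    obtain D where D: "D \<in> P" "B = D \<inter> pm_set n" using h(1) unfolding restrict_blocks_def by blast
    then have "k \<in> {1..int r} \<inter> D" using h(2) by blast
    then have "- j \<notin> D \<and> (j \<in> D \<longrightarrow> j = k)" using R D(1) h(3) by metis
    then show "- j \<notin> B \<and> (j \<in> B \<longrightarrow> j = k)" using D(2) by blast
  qed
qed

definition r_partitions :: "nat \<Rightarrow> nat \<Rightarrow> nat \<Rightarrow> int set set set" where
  "r_partitions n k r =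
     {P. type_B_partition n P \<and> card (nonzero_block_pairs P) = k \<and> r_separated r P}"

lemma r_stirling_B_eq: "r \<le> n \<Longrightarrow> r_stirling_B n k r = card (r_partitions n k r)"
  by (simp add: r_stirling_B_def r_partitions_def)

lemma finite_r_partitions: "finite (r_partitions n k r)"
  by (rule finite_subset[OF _ finite_type_B_partitions[of n]]) (auto simp: r_partitions_def)

lemma r_stirling_B_Suc:
  assumes r: "r \<le> n"
  shows "r_stirling_B (Suc n) k r =
    (if k = 0 then 0 else r_stirling_B n (k - 1) r) + (2 * k + 1) * r_stirling_B n k r"
proof -
  define x where "x = int n + 1"
  define F where "F = (\<lambda>(Q, A). extend_by Q A)"
  \<comment> \<open>\<open>D0\<close> and \<open>D1\<close> parametrize the partitions in which \<open>x\<close> is alone in its block and the others.\<close>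
  define D0 where "D0 = (if k = 0 then {} else r_partitions n (k - 1) r \<times> {{x}})"
  define D1 where "D1 = (SIGMA Q:r_partitions n k r. new_block_choices n Q - {{x}})"
  have sub: "D0 \<union> D1 \<subseteq> (SIGMA Q:{Q. type_B_partition n Q}. new_block_choices n Q)"
    by (auto simp: D0_def D1_def r_partitions_def new_block_choices_def x_def split: if_splits)
  have ext: "extend_by Q A \<in> r_partitions (Suc n) k r \<longleftrightarrow> (Q, A) \<in> D0 \<union> D1"
    if Q: "type_B_partition n Q" and A: "A \<in> new_block_choices n Q" for Q A
    using Q A extend_by_type_B[OF Q A] card_nonzero_block_pairs_extend_by[OF Q A]
      r_separated_restrict_blocks[OF extend_by_type_B[OF Q A] r] restrict_extend_by[OF Q A]
    by (auto simp: D0_def D1_def r_partitions_def x_def)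
  have "F ` (D0 \<union> D1) = r_partitions (Suc n) k r"
  proof (intro equalityI subsetI)
    fix P assume "P \<in> F ` (D0 \<union> D1)"
    then show "P \<in> r_partitions (Suc n) k r" using ext sub unfolding F_def by auto
  next
    fix P assume P: "P \<in> r_partitions (Suc n) k r"
    then have "P \<in> F ` (SIGMA Q:{Q. type_B_partition n Q}. new_block_choices n Q)"
      using bij_betw_imp_surj_on[OF bij_betw_extend_by[of n]]
      unfolding F_def r_partitions_def by blast
    then obtain Q A where "type_B_partition n Q" "A \<in> new_block_choices n Q" "P = extend_by Q A"
      unfolding F_def by auto
    moreover from this have "(Q, A) \<in> D0 \<union> D1" using ext P by blast
    ultimately show "P \<in> F ` (D0 \<union> D1)" unfolding F_def by force
  qed
  moreover have "inj_on F (D0 \<union> D1)"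
    using bij_betw_imp_inj_on[OF bij_betw_extend_by[of n]] sub unfolding F_def
    by (rule inj_on_subset)
  ultimately have "card (r_partitions (Suc n) k r) = card (D0 \<union> D1)"
    using card_image by metis
  also have "\<dots> = card D0 + card D1"
  proof (rule card_Un_disjoint)
    show "finite D0" by (simp add: D0_def finite_r_partitions)
    have "finite (new_block_choices n Q)" if "Q \<in> r_partitions n k r" for Q
      using that finite_type_B_partition
      by (auto simp: r_partitions_def new_block_choices_def nonzero_blocks_def)
    then show "finite D1" by (auto simp: D1_def finite_r_partitions)
    show "D0 \<inter> D1 = {}" by (auto simp: D0_def D1_def)
  qed
  also have "card D1 = (\<Sum>Q\<in>r_partitions n k r. 2 * k + 1)"
  proof -
    have c: "card (new_block_choices n Q - {{x}}) = 2 * k + 1" if "Q \<in> r_partitions n k r" for Q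
      using that card_new_block_choices[of n Q] by (simp add: r_partitions_def x_def)
    have "finite (new_block_choices n Q - {{x}})" if "Q \<in> r_partitions n k r" for Q
      by (rule card_ge_0_finite) (simp add: c[OF that])
    then show ?thesis using c unfolding D1_def by (simp add: card_SigmaI finite_r_partitions)
  qed
  also have "card D0 = (if k = 0 then 0 else card (r_partitions n (k - 1) r))"
    by (simp add: D0_def card_cartesian_product)
  finally show ?thesis using r by (simp add: r_stirling_B_eq mult.commute)
qed

lemma r_stirling_B_diag: "r_stirling_B r k r = (if k = r then 1 else 0)"
proof -
  define S where "S = (\<lambda>a::int. {a}) ` pm_set r"
  have S: "type_B_partition r S"
    by (rule type_B_partitionI) (auto simp: S_def is_zero_block_def pm_set_def)
  have "nonzero_blocks S = S" by (auto simp: nonzero_blocks_def S_def is_zero_block_def pm_set_def)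
  moreover have "card S = 2 * r"
  proof -
    have "pm_set r = {1..int r} \<union> {- int r..-1}" by (auto simp: pm_set_def)
    moreover have "card ({1..int r} \<union> {- int r..-1}) = 2 * r"
      by (subst card_Un_disjoint) auto
    ultimately show ?thesis unfolding S_def by (simp add: card_image)
  qed
  ultimately have cS: "card (nonzero_block_pairs S) = r" using card_nonzero_blocks[OF S] by simp
  have sS: "r_separated r S" unfolding r_separated_iff[OF S] by (auto simp: S_def)
  \<comment> \<open>Two elements of one block are \<open>\<plusminus>i\<close> and \<open>\<plusminus>j\<close> with \<open>i, j \<le> r\<close>. Up to negating the block one of them
      is positive, and then separation makes them equal.\<close>
  have uniq: "P = S" if P: "type_B_partition r P" and s: "r_separated r P" for P
  proof -
    have pos: "b = a" if h: "B \<in> P" "a \<in> B" "b \<in> B" "a > 0" for B a b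
    proof -
      have ab: "a \<in> pm_set r" "b \<in> pm_set r" using type_B_block_subset[OF P h(1)] h by blast+
      have a: "a \<in> {1..int r} \<inter> B" using ab h by (auto simp: pm_set_def)
      have j: "- j \<notin> B \<and> (j \<in> B \<longrightarrow> j = a)" if "j \<in> {1..int r}" for j
        using s[unfolded r_separated_iff[OF P]] h(1) a that by blast
      show ?thesis
      proof (cases "b > 0")
        case True
        then show ?thesis using j[of b] ab h by (auto simp: pm_set_def)
      next
        case False
        then show ?thesis using j[of "- b"] ab h by (auto simp: pm_set_def)
      qed
    qed
    have eq: "b = a" if h: "B \<in> P" "a \<in> B" "b \<in> B" for B a b
    proof (cases "a > 0")
      case True
      then show ?thesis using pos h by blast
    next
      case False
      then have "- a > 0" using type_B_block_subset[OF P h(1)] h(2) by (auto simp: pm_set_def)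
      then have "- b = - a"
        using pos[OF type_B_uminus[OF P h(1)], of "- a" "- b"] h by blast
      then show ?thesis by simp
    qed
    have sing: "B = {a}" if "B \<in> P" "a \<in> B" for B a using eq that by blast
    show ?thesis
    proof (intro equalityI subsetI)
      fix B assume B: "B \<in> P"
      then obtain a where "a \<in> B" using type_B_empty[OF P] by (metis ex_in_conv)
      then show "B \<in> S" using sing[OF B] type_B_block_subset[OF P B] unfolding S_def by blast
    next
      fix B assume "B \<in> S"
      then obtain a where a: "a \<in> pm_set r" "B = {a}" unfolding S_def by blast
      then show "B \<in> P" using type_B_cover[OF P a(1)] sing by metis
    qed
  qed
  have "P \<in> r_partitions r k r \<longleftrightarrow> P = S \<and> k = r" for P
    using S cS sS uniq[of P] unfolding r_partitions_def by auto
  then have "r_partitions r k r = (if k = r then {S} else {})"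
    by (intro set_eqI) simp
  then show ?thesis by (simp add: r_stirling_B_eq)
qed

lemma r_stirling_B_0: "r_stirling_B n k 0 = stirling_B n k"
  by (simp add: r_stirling_B_def stirling_B_def r_separated_def)

text \<open>
  The elements \<open>1, ..., r\<close> occupy \<open>r\<close> different pairs. This is needed for \<open>k = r - 1\<close>, where the
  recurrence would otherwise contribute a term that the binomial sum lacks.
\<close>

lemma r_stirling_B_eq_0: "k < r \<Longrightarrow> r_stirling_B (n + r) k r = 0"
proof (induction n arbitrary: k)
  case 0
  then show ?case by (simp add: r_stirling_B_diag)
next
  case (Suc n)
  then show ?case by (simp add: r_stirling_B_Suc)
qed

lemma stirling_B_0: "stirling_B 0 k = (if k = 0 then 1 else 0)"
  using r_stirling_B_diag[of 0 k] by (simp add: r_stirling_B_0)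

lemma stirling_B_Suc:
  "stirling_B (Suc n) k = (if k = 0 then 0 else stirling_B n (k - 1)) + (2 * k + 1) * stirling_B n k"
  using r_stirling_B_Suc[of 0 n k] by (simp add: r_stirling_B_0)

lemma stirling_B_eq_0: "n < k \<Longrightarrow> stirling_B n k = 0"
  by (induction n arbitrary: k) (simp_all add: stirling_B_0 stirling_B_Suc)

section \<open>The binomial transform\<close>

text \<open>
  For the binomial transform \<open>T\<close> with parameter \<open>c\<close>, Pascal's rule says that
  \<open>T f (n + 1) = c * T f n + T (f \<circ> Suc) n\<close>.
\<close>

lemma sum_choose_Suc:
  fixes f :: "nat \<Rightarrow> nat"
  shows "(\<Sum>j\<le>Suc n. (Suc n choose j) * f j * c ^ (Suc n - j)) =
    c * (\<Sum>j\<le>n. (n choose j) * f j * c ^ (n - j)) +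
    (\<Sum>j\<le>n. (n choose j) * f (Suc j) * c ^ (n - j))"
proof -
  have "(\<Sum>j\<le>n. (n choose Suc j) * f (Suc j) * c ^ (n - j)) + f 0 * c ^ Suc n
      = (\<Sum>j\<le>Suc n. (n choose j) * f j * c ^ (Suc n - j))"
    by (subst sum.atMost_Suc_shift) simp
  also have "\<dots> = (\<Sum>j\<le>n. (n choose j) * f j * c ^ (Suc n - j))"
    by simp
  also have "\<dots> = c * (\<Sum>j\<le>n. (n choose j) * f j * c ^ (n - j))"
    unfolding sum_distrib_left by (rule sum.cong) (auto simp: Suc_diff_le)
  finally have *: "(\<Sum>j\<le>n. (n choose Suc j) * f (Suc j) * c ^ (n - j)) + f 0 * c ^ Suc n
      = c * (\<Sum>j\<le>n. (n choose j) * f j * c ^ (n - j))" .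
  have "(\<Sum>j\<le>Suc n. (Suc n choose j) * f j * c ^ (Suc n - j)) =
      f 0 * c ^ Suc n + (\<Sum>j\<le>n. (Suc n choose Suc j) * f (Suc j) * c ^ (n - j))"
    by (subst sum.atMost_Suc_shift) simp
  also have "\<dots> = f 0 * c ^ Suc n + (\<Sum>j\<le>n. (n choose Suc j) * f (Suc j) * c ^ (n - j))
      + (\<Sum>j\<le>n. (n choose j) * f (Suc j) * c ^ (n - j))"
    by (simp add: sum.distrib[symmetric] algebra_simps)
  finally show ?thesis using * by simp
qed

lemma r_stirling_B_binomial_transform:
  "r_stirling_B (n + r) (k + r) r = (\<Sum>j\<le>n. (n choose j) * stirling_B j k * (2 * r) ^ (n - j))"
proof (induction n arbitrary: k)
  case 0
  then show ?case by (simp add: r_stirling_B_diag stirling_B_0)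
next
  case (Suc n)
  define G where "G k = (\<Sum>j\<le>n. (n choose j) * stirling_B j k * (2 * r) ^ (n - j))" for k
  have G: "(\<Sum>j\<le>n. (n choose j) * stirling_B (Suc j) k * (2 * r) ^ (n - j)) =
      (if k = 0 then 0 else G (k - 1)) + (2 * k + 1) * G k"
    unfolding G_def sum_distrib_left stirling_B_Suc
    by (simp add: sum.distrib[symmetric] algebra_simps)
  have "r_stirling_B (Suc n + r) (k + r) r =
      (if k + r = 0 then 0 else r_stirling_B (n + r) (k + r - 1) r)
      + (2 * (k + r) + 1) * G k"
    using r_stirling_B_Suc[of r "n + r" "k + r"] Suc.IH[of k] by (simp add: G_def)
  also have "(if k + r = 0 then 0 else r_stirling_B (n + r) (k + r - 1) r) =
      (if k = 0 then 0 else G (k - 1))"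
  proof (cases k)
    case 0
    then show ?thesis using r_stirling_B_eq_0[of "r - 1" r n] by auto
  next
    case (Suc m)
    then show ?thesis using Suc.IH[of m] by (simp add: G_def)
  qed
  finally show ?case
    unfolding sum_choose_Suc G G_def[symmetric] by (simp add: algebra_simps)
qed

theorem proposition3p8:
  fixes n k r :: nat
  assumes "k \<le> n" and "r > 0"
  shows "r_stirling_B (n + r) (k + r) r =
           (\<Sum>j = k..n. (n choose j) * stirling_B j k * (2 * r) ^ (n - j))"
  unfolding r_stirling_B_binomial_transform
  \<comment> \<open>The terms with \<open>j < k\<close> vanish.\<close>
  by (rule sum.mono_neutral_right) (auto simp: stirling_B_eq_0)

end
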